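(* Let $T$ be a continuous bundle random dynamical system over $(\Omega,\mathcal{F},\mathbb{P},\vartheta)$ with bundle $\mathcal{E}\subset\Omega\times X$. If $T$ has the small boundary property, then $\mathrm{mdim}(T)=0$.
   Context: Setting. $(\Omega,\mathcal{F},\mathbb{P})$ is a complete probability space, $\vartheta:\Omega\to\Omega$ is a $\mathbb{P}$-preserving transformation, $(X,d)$ is a compact metric space with Borel $\sigma$-algebra $\mathcal{B}$. $\mathcal{E}\subset\Omega\times X$ is measurable with respect to $\mathcal{F}\otimes\mathcal{B}$ and its fibers $\mathcal{E}_\omega=\{x\in X:(\omega,x)\in\mathcal{E}\}$ are nonempty compact subsets of $X$. A continuous bundle random dynamical system (RDS) $T$ over $(\Omega,\mathcal{F},\mathbb{P},\vartheta)$ is given by maps $T_\omega:\mathcal{E}_\omega\to\mathcal{E}_{\vartheta\omega}$ such that $(\omega,x)\mapsto T_\omega x$ is measurable and $x\mapsto T_\omega x$ is continuous for $\mathbb{P}$-almost all $\omega$. Put $T^n_\omega=T_{\vartheta^{n-1}\omega}\circ\cdots\circ T_{\vartheta\omega}\circ T_\omega$ for $n\ge1$ and $T^0_\omega=\mathrm{id}$. $\mathbb{E}$ denotes expectation with respect to $\mathbb{P}$. Covers. For a finite open cover $\alpha$ of a compact set $K\subset X$, $\mathrm{ord}(\alpha)=-1+\sup_{x\in K}\sum_{U\in\alpha}1_U(x)$ and $\mathcal{D}(\alpha)=\min_{\beta\succ\alpha}\mathrm{ord}(\beta)$, where $\beta$ runs over all finite open covers of $K$ refining $\alpha$ (every member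 of $\beta$ is contained in a member of $\alpha$). For a finite open cover $\alpha$ of $X$, $\alpha(\omega|\mathcal{E})=\{A\cap\mathcal{E}_\omega:A\in\alpha\}$ is an open cover of $\mathcal{E}_\omega$, and $\alpha_0^{n-1}(\omega|\mathcal{E})=\bigvee_{i=0}^{n-1}(T^i_\omega)^{-1}\alpha(\vartheta^i\omega|\mathcal{E})$ is the open cover of $\mathcal{E}_\omega$ by all sets $\bigcap_{i=0}^{n-1}(T^i_\omega)^{-1}(A_i\cap\mathcal{E}_{\vartheta^i\omega})$ with $A_i\in\alpha$. Mean topological dimension. $\mathrm{mdim}(T,\alpha)=\lim_{n\to\infty}\frac1n\,\mathbb{E}\,\mathcal{D}(\alpha_0^{n-1}(\omega|\mathcal{E}))$ (the limit exists), and $\mathrm{mdim}(T)=\sup_\alpha\mathrm{mdim}(T,\alpha)$ over all finite open covers $\alpha$ of $X$. Small boundary property. For a Borel set $E\subset X$, the $\omega$-orbit capacity is $\mathrm{ocap}^\omega(E)=\lim_{n\to\infty}\frac1n\sup_{x\in\mathcal{E}_\omega}\sum_{i=0}^{n-1}1_E(T^i_\omega x)$ (the limit exists for $\mathbb{P}$-almost all $\omega$). $E$ is called $T$-small (or small) if $\mathrm{ocap}^\omega(E)=0$ for $\mathbb{P}$-almost all $\omega$. $T$ has the small boundary property (SBP) if for every point $x\in X$ and every open set $U\subset X$ containing $x$ there is a neighborhood $V\subset U$ of $x$ whose boundary $\partial V$ is small. *)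

theory Defs
  imports "HOL-Probability.Probability"
begin

section \<open>Continuous bundle random dynamical systems\<close>

definition fiber :: "('w \<times> 'x) set \<Rightarrow> 'w \<Rightarrow> 'x set" where
  "fiber E \<omega> = {x. (\<omega>, x) \<in> E}"

text \<open>The compact metric space is the whole type \<open>'x\<close>. The values of \<open>T \<omega>\<close> outside the fiber
  over \<open>\<omega>\<close> are irrelevant; measurability is with respect to the trace sigma-algebra on \<open>E\<close>.\<close>

locale continuous_bundle_rds = prob_space M + complete_measure M
  for M :: "'w measure" +
  fixes \<theta> :: "'w \<Rightarrow> 'w"
    and E :: "('w \<times> 'x::metric_space) set"
    and T :: "'w \<Rightarrow> 'x \<Rightarrow> 'x"
  assumes compact_UNIV: "compact (UNIV :: 'x set)"
    and base_measurable: "\<theta> \<in> measurable M M"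
    and base_preserving: "distr M M \<theta> = M"
    and bundle_measurable: "E \<in> sets (M \<Otimes>\<^sub>M (borel :: 'x measure))"
    and fiber_nonempty: "\<And>\<omega>. \<omega> \<in> space M \<Longrightarrow> fiber E \<omega> \<noteq> {}"
    and fiber_compact: "\<And>\<omega>. \<omega> \<in> space M \<Longrightarrow> compact (fiber E \<omega>)"
    and fiber_map: "\<And>\<omega>. \<omega> \<in> space M \<Longrightarrow> T \<omega> ` fiber E \<omega> \<subseteq> fiber E (\<theta> \<omega>)"
    and map_measurable:
      "(\<lambda>(\<omega>, x). T \<omega> x) \<in> measurable (restrict_space (M \<Otimes>\<^sub>M borel) E) borel"
    and map_continuous: "AE \<omega> in M. continuous_on (fiber E \<omega>) (T \<omega>)"

fun cocycle :: "('w \<Rightarrow> 'w) \<Rightarrow> ('w \<Rightarrow> 'x \<Rightarrow> 'x) \<Rightarrow> nat \<Rightarrow> 'w \<Rightarrow> 'x \<Rightarrow> 'x" where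
  "cocycle \<theta> T 0 \<omega> = id"
| "cocycle \<theta> T (Suc n) \<omega> = T ((\<theta> ^^ n) \<omega>) \<circ> cocycle \<theta> T n \<omega>"


section \<open>Covers\<close>

text \<open>Members of a cover of \<open>K\<close> are subsets of \<open>K\<close> that are open relative to \<open>K\<close>.\<close>

definition finite_open_cover :: "'x::topological_space set \<Rightarrow> 'x set set \<Rightarrow> bool" where
  "finite_open_cover K \<alpha> \<longleftrightarrow>
     finite \<alpha> \<and> (\<forall>U\<in>\<alpha>. openin (top_of_set K) U) \<and> \<Union>\<alpha> = K"

definition refines :: "'x set set \<Rightarrow> 'x set set \<Rightarrow> bool" where
  "refines \<beta> \<alpha> \<longleftrightarrow> (\<forall>V\<in>\<beta>. \<exists>U\<in>\<alpha>. V \<subseteq> U)"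

definition cover_ord :: "'x set \<Rightarrow> 'x set set \<Rightarrow> int" where
  "cover_ord K \<alpha> = - 1 + (SUP x\<in>K. \<Sum>U\<in>\<alpha>. indicator U x)"

text \<open>The infimum of a nonempty, bounded below set of integers is attained, so this is a minimum
  whenever \<open>\<alpha>\<close> has a finite open refinement and \<open>K\<close> is nonempty.\<close>

definition cover_dim :: "'x::topological_space set \<Rightarrow> 'x set set \<Rightarrow> int" where
  "cover_dim K \<alpha> = (INF \<beta>\<in>{\<beta>. finite_open_cover K \<beta> \<and> refines \<beta> \<alpha>}. cover_ord K \<beta>)"

definition trace_cover :: "('w \<times> 'x) set \<Rightarrow> 'x set set \<Rightarrow> 'w \<Rightarrow> 'x set set" where
  "trace_cover E \<alpha> \<omega> = (\<lambda>A. A \<inter> fiber E \<omega>) ` \<alpha>"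

text \<open>The join over \<open>i < n\<close> of the pullbacks of the traces of \<open>\<alpha>\<close> along the orbit of \<open>\<omega>\<close>: a member
  is determined by a choice of a member \<open>B i\<close> of the trace over the \<open>i\<close>-th base point.\<close>

definition iterated_cover ::
  "('w \<Rightarrow> 'w) \<Rightarrow> ('w \<times> 'x) set \<Rightarrow> ('w \<Rightarrow> 'x \<Rightarrow> 'x) \<Rightarrow> 'x set set \<Rightarrow> nat \<Rightarrow> 'w \<Rightarrow> 'x set set" where
  "iterated_cover \<theta> E T \<alpha> n \<omega> =
     {{x \<in> fiber E \<omega>. \<forall>i<n. cocycle \<theta> T i \<omega> x \<in> B i} | B.
        \<forall>i<n. B i \<in> trace_cover E \<alpha> ((\<theta> ^^ i) \<omega>)}"


section \<open>Mean topological dimension\<close>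

definition mdim_cover ::
  "'w measure \<Rightarrow> ('w \<Rightarrow> 'w) \<Rightarrow> ('w \<times> 'x::metric_space) set \<Rightarrow> ('w \<Rightarrow> 'x \<Rightarrow> 'x) \<Rightarrow> 'x set set \<Rightarrow> real"
  where
  "mdim_cover M \<theta> E T \<alpha> =
     lim (\<lambda>n. (1 / real n) *
       (\<integral>\<omega>. real_of_int (cover_dim (fiber E \<omega>) (iterated_cover \<theta> E T \<alpha> n \<omega>)) \<partial>M))"

definition mdim ::
  "'w measure \<Rightarrow> ('w \<Rightarrow> 'w) \<Rightarrow> ('w \<times> 'x::metric_space) set \<Rightarrow> ('w \<Rightarrow> 'x \<Rightarrow> 'x) \<Rightarrow> ereal" where
  "mdim M \<theta> E T = (SUP \<alpha>\<in>{\<alpha>. finite_open_cover UNIV \<alpha>}. ereal (mdim_cover M \<theta> E T \<alpha>))"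


section \<open>Small boundary property\<close>

definition max_visit_freq ::
  "('w \<Rightarrow> 'w) \<Rightarrow> ('w \<times> 'x) set \<Rightarrow> ('w \<Rightarrow> 'x \<Rightarrow> 'x) \<Rightarrow> 'w \<Rightarrow> 'x set \<Rightarrow> nat \<Rightarrow> real" where
  "max_visit_freq \<theta> E T \<omega> A n =
     (1 / real n) * (SUP x\<in>fiber E \<omega>. \<Sum>i<n. indicator A (cocycle \<theta> T i \<omega> x))"

definition ocap ::
  "('w \<Rightarrow> 'w) \<Rightarrow> ('w \<times> 'x) set \<Rightarrow> ('w \<Rightarrow> 'x \<Rightarrow> 'x) \<Rightarrow> 'w \<Rightarrow> 'x set \<Rightarrow> real" where
  "ocap \<theta> E T \<omega> A = lim (max_visit_freq \<theta> E T \<omega> A)"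

text \<open>The limit defining \<open>ocap\<close> exists almost surely (subadditive ergodic theorem). Since \<open>lim\<close> is
  unspecified for divergent sequences, "\<open>ocap\<close> is zero" is spelled out as
  "the limit exists and is zero".\<close>

definition small_set ::
  "'w measure \<Rightarrow> ('w \<Rightarrow> 'w) \<Rightarrow> ('w \<times> 'x::metric_space) set \<Rightarrow> ('w \<Rightarrow> 'x \<Rightarrow> 'x) \<Rightarrow> 'x set \<Rightarrow> bool"
  where
  "small_set M \<theta> E T A \<longleftrightarrow> A \<in> sets borel \<and>
     (AE \<omega> in M. convergent (max_visit_freq \<theta> E T \<omega> A) \<and> ocap \<theta> E T \<omega> A = 0)"

definition small_boundary_property ::
  "'w measure \<Rightarrow> ('w \<Rightarrow> 'w) \<Rightarrow> ('w \<times> 'x::metric_space) set \<Rightarrow> ('w \<Rightarrow> 'x \<Rightarrow> 'x) \<Rightarrow> bool" where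
  "small_boundary_property M \<theta> E T \<longleftrightarrow>
     (\<forall>x U. open U \<and> x \<in> U \<longrightarrow>
        (\<exists>V. V \<subseteq> U \<and> x \<in> interior V \<and> small_set M \<theta> E T (frontier V)))"

end

(* On a fixed fiber the n-step orbit visits small frontiers at most m = o(n) times. Tent functions
   of the distances to the sets with small frontier map the fiber to a cube so that, by compactness
   and for thin enough tents, every image point has at most m coordinates strictly between 0 and 1.
   Pulling back the vertex stars of the Kuhn triangulation of the cube gives a refinement of the
   iterated cover: the stars at a point form a chain of at most m + 1 vertices, so the order is at
   most m. The thickness of the tents may depend on n and on the base point, hence no measurable or
   uniform choice is needed, and dominated convergence finishes the proof. *)

theory Submission
  imports Defs
begin

section \<open>Order and dimension of covers\<close>

lemma sum_indicator_le_card: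
  "(\<Sum>i\<in>I. indicator (A i) (y i) :: 'a::linordered_semidom) \<le> of_nat (card I)"
  using sum_bounded_above[of I "\<lambda>i. indicator (A i) (y i)" "1::'a"] by (simp add: indicator_def)

text \<open>Any point lies in some member, so the supremum is at least 1. This is the lower bound
  that the infimum in \<open>cover_dim\<close> needs, the integers being only conditionally
  complete.\<close>

lemma cover_ord_nonneg:
  assumes "finite_open_cover K \<beta>" "K \<noteq> {}"
  shows "0 \<le> cover_ord K \<beta>"
proof -
  obtain x where x: "x \<in> K" using assms(2) by blast
  then obtain U where U: "U \<in> \<beta>" "x \<in> U" using assms(1) unfolding finite_open_cover_def by blast
  have fin: "finite \<beta>" using assms(1) unfolding finite_open_cover_def by blast
  have "(1::int) = indicator U x" using U by simp
  also have "\<dots> \<le> (\<Sum>U\<in>\<beta>. indicator U x)"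
    using U fin by (intro member_le_sum) auto
  also have "\<dots> \<le> (SUP x\<in>K. \<Sum>U\<in>\<beta>. indicator U x)"
    using x by (intro cSUP_upper) (auto intro!: bdd_aboveI sum_indicator_le_card)
  finally show ?thesis unfolding cover_ord_def by simp
qed

lemma cover_dim_bounds:
  assumes "finite_open_cover K \<beta>" "refines \<beta> \<alpha>" "K \<noteq> {}"
  shows "0 \<le> cover_dim K \<alpha>" "cover_dim K \<alpha> \<le> cover_ord K \<beta>"
proof -
  show "0 \<le> cover_dim K \<alpha>"
    unfolding cover_dim_def using assms by (intro cINF_greatest) (auto intro: cover_ord_nonneg)
  show "cover_dim K \<alpha> \<le> cover_ord K \<beta>"
    unfolding cover_dim_def using assms
    by (intro cINF_lower) (auto intro!: bdd_belowI[of _ 0] cover_ord_nonneg)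
qed

section \<open>Kuhn stars and collars of frontiers\<close>

text \<open>Along a chain, the size of \<open>S - L\<close> determines \<open>S\<close>, and it can
  only take the values from 0 to \<open>card D\<close>.\<close>

lemma card_chain_between_le:
  fixes C :: "'a set set"
  assumes fin: "finite D"
    and chain: "\<And>S S'. S \<in> C \<Longrightarrow> S' \<in> C \<Longrightarrow> S \<subseteq> S' \<or> S' \<subseteq> S"
    and between: "\<And>S. S \<in> C \<Longrightarrow> L \<subseteq> S \<and> S \<subseteq> L \<union> D"
  shows "card C \<le> card D + 1"
proof -
  have fS: "finite (S - L)" "S - L \<subseteq> D" if "S \<in> C" for S
    using between[OF that] fin by (auto intro: finite_subset)
  have "inj_on (\<lambda>S. card (S - L)) C"
  proof (rule inj_onI)
    have *: "S = S'" if S: "S \<in> C" "S' \<in> C" "card (S - L) = card (S' - L)" "S \<subseteq> S'" for S S'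
    proof -
      have "S - L = S' - L" using S fS by (intro card_subset_eq) auto
      then show ?thesis using between S by blast
    qed
    fix S S' assume S: "S \<in> C" "S' \<in> C" and eq: "card (S - L) = card (S' - L)"
    show "S = S'" using chain[OF S] *[OF S eq] *[OF S(2,1) eq[symmetric]] by auto
  qed
  moreover have "(\<lambda>S. card (S - L)) ` C \<subseteq> {..card D}"
    using fS fin by (auto intro: card_mono)
  ultimately have "card C \<le> card {..card D}" by (intro card_inj_on_le) auto
  then show ?thesis by simp
qed

text \<open>The open star of the vertex \<open>S\<close> in the Kuhn triangulation of the cube \<open>[0, 1]\<^sup>I\<close>,
  pulled back along \<open>t\<close>.\<close>

definition kuhn_star :: "'x set \<Rightarrow> 'i set \<Rightarrow> ('i \<Rightarrow> 'x \<Rightarrow> real) \<Rightarrow> 'i set \<Rightarrow> 'x set" where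
  "kuhn_star K I t S =
     {x\<in>K. (\<forall>a\<in>S. 0 < t a x) \<and> (\<forall>b\<in>I - S. t b x < 1) \<and> (\<forall>a\<in>S. \<forall>b\<in>I - S. t b x < t a x)}"

lemma openin_kuhn_star:
  fixes t :: "'i \<Rightarrow> 'x::topological_space \<Rightarrow> real"
  assumes "finite I" "S \<subseteq> I" and cont: "\<And>a. a \<in> I \<Longrightarrow> continuous_on K (t a)"
  shows "openin (top_of_set K) (kuhn_star K I t S)"
proof -
  have lt: "openin (top_of_set K) {x\<in>K. f x < g x}"
    if "continuous_on K f" "continuous_on K g" for f g :: "'x \<Rightarrow> real"
    using continuous_openin_preimage_gen[OF continuous_on_diff[OF that(2,1)], of "{0<..}"]
    by (simp add: vimage_def Int_def conj_commute)
  have finS: "finite S" "finite (I - S)" using assms(1,2) finite_subset by auto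
  have Ball: "openin (top_of_set K) {x\<in>K. \<forall>a\<in>A. P a x}"
    if "finite A" "\<And>a. a \<in> A \<Longrightarrow> openin (top_of_set K) {x\<in>K. P a x}" for A :: "'i set" and P
    using that
  proof (induction A rule: finite_induct)
    case empty
    then show ?case by simp
  next
    case (insert a A)
    have "{x\<in>K. \<forall>a\<in>insert a A. P a x} = {x\<in>K. P a x} \<inter> {x\<in>K. \<forall>a\<in>A. P a x}" by auto
    then show ?case using insert by auto
  qed
  have "kuhn_star K I t S = {x\<in>K. \<forall>a\<in>S. 0 < t a x} \<inter> {x\<in>K. \<forall>b\<in>I - S. t b x < 1}
      \<inter> {x\<in>K. \<forall>a\<in>S. \<forall>b\<in>I - S. t b x < t a x}"
    unfolding kuhn_star_def by blast
  also have "openin (top_of_set K) \<dots>"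
    using assms finS by (intro openin_Int Ball lt cont) auto
  finally show ?thesis .
qed

text \<open>The vertices whose stars contain \<open>x\<close> form a chain. Each of them contains
  all coordinates equal to 1 and otherwise only fractional ones, so there are at most
  \<open>m + 1\<close>; the \<open>- 1\<close> in \<open>cover_ord\<close> absorbs the extra
  one.\<close>

lemma kuhn_cover:
  fixes t :: "'i \<Rightarrow> 'x::topological_space \<Rightarrow> real"
  assumes fin: "finite I" and cont: "\<And>a. a \<in> I \<Longrightarrow> continuous_on K (t a)" and "K \<noteq> {}"
    and bounds: "\<And>a x. a \<in> I \<Longrightarrow> x \<in> K \<Longrightarrow> 0 \<le> t a x \<and> t a x \<le> 1"
    and m: "\<And>x. x \<in> K \<Longrightarrow> card {a\<in>I. 0 < t a x \<and> t a x < 1} \<le> m"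
  shows "finite_open_cover K (kuhn_star K I t ` Pow I)"
    and "cover_ord K (kuhn_star K I t ` Pow I) \<le> int m"
proof -
  let ?O = "kuhn_star K I t"
  \<comment> \<open>Rounding at 1/2 yields a vertex whose star contains \<open>x\<close>: selected
    coordinates are at least 1/2, all others lie strictly below 1/2.\<close>
  have cov: "x \<in> ?O {a\<in>I. 1/2 \<le> t a x}" if "x \<in> K" for x
    using that unfolding kuhn_star_def by auto
  have "K \<subseteq> \<Union>(?O ` Pow I)"
  proof
    fix x assume "x \<in> K"
    then have "x \<in> ?O {a\<in>I. 1/2 \<le> t a x}" by (rule cov)
    moreover have "{a\<in>I. 1/2 \<le> t a x} \<in> Pow I" by blast
    ultimately show "x \<in> \<Union>(?O ` Pow I)" by (rule UN_I[rotated])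
  qed
  moreover have "?O S \<subseteq> K" for S unfolding kuhn_star_def by auto
  ultimately have "\<Union>(?O ` Pow I) = K" by blast
  then show "finite_open_cover K (?O ` Pow I)"
    unfolding finite_open_cover_def using fin cont by (auto intro: openin_kuhn_star)
  have "(\<Sum>U\<in>?O ` Pow I. indicator U x :: int) \<le> 1 + int m" if x: "x \<in> K" for x
  proof -
    let ?C = "{S\<in>Pow I. x \<in> ?O S}" and ?D = "{a\<in>I. 0 < t a x \<and> t a x < 1}"
    have "(\<Sum>U\<in>?O ` Pow I. indicator U x :: int) = int (card {U\<in>?O ` Pow I. x \<in> U})"
      using fin by (simp add: indicator_def sum.If_cases Int_def conj_commute)
    also have "{U\<in>?O ` Pow I. x \<in> U} = ?O ` ?C" by blast
    \<comment> \<open>Different vertices may have the same star as a set, and the cover counts it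
      once; hence only an inequality.\<close>
    also have "card (?O ` ?C) \<le> card ?C" using fin by (intro card_image_le) simp
    also have "card ?C \<le> card ?D + 1"
    proof (rule card_chain_between_le[where L = "{a\<in>I. t a x = 1}"])
      show "finite ?D" using fin by simp
      fix S assume S: "S \<in> ?C"
      show "{a\<in>I. t a x = 1} \<subseteq> S \<and> S \<subseteq> {a\<in>I. t a x = 1} \<union> ?D"
        using S bounds[OF _ x] unfolding kuhn_star_def by (force simp: less_le)
      fix S' assume S': "S' \<in> ?C"
      show "S \<subseteq> S' \<or> S' \<subseteq> S"
      proof (rule ccontr)
        assume "\<not> (S \<subseteq> S' \<or> S' \<subseteq> S)"
        then obtain a b where "a \<in> S - S'" "b \<in> S' - S" by blast
        then have "t b x < t a x" "t a x < t b x"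
          using S S' unfolding kuhn_star_def by auto
        then show False by simp
      qed
    qed
    also have "card ?D + 1 \<le> m + 1" using m[OF x] by simp
    finally show ?thesis by simp
  qed
  then have "(SUP x\<in>K. \<Sum>U\<in>?O ` Pow I. indicator U x) \<le> 1 + int m"
    using \<open>K \<noteq> {}\<close> by (intro cSUP_least)
  then show "cover_ord K (?O ` Pow I) \<le> int m" unfolding cover_ord_def by simp
qed

text \<open>A point that is close to \<open>V a\<close> without being in \<open>V a\<close> is almost in the frontier, so by
  compactness the number of frontier visits does not increase when the frontiers are thickened
  slightly.\<close>

lemma eventually_card_collar_le:
  fixes f :: "'i \<Rightarrow> 'x::topological_space \<Rightarrow> 'y::metric_space"
  assumes K: "compact K" and fin: "finite I"
    and cont: "\<And>a. a \<in> I \<Longrightarrow> continuous_on K (f a)"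
    and V: "\<And>a. a \<in> I \<Longrightarrow> open (V a) \<and> V a \<noteq> {}"
    and m: "\<And>x. x \<in> K \<Longrightarrow> card {a\<in>I. f a x \<in> frontier (V a)} \<le> m"
  shows "\<forall>\<^sub>F \<delta> in at_right (0::real).
    \<forall>x\<in>K. card {a\<in>I. 0 < infdist (f a x) (V a) \<and> infdist (f a x) (V a) < \<delta>} \<le> m"
proof -
  \<comment> \<open>It suffices to exclude each index set \<open>J\<close> of more than
    \<open>m\<close> elements separately: a point outside all \<open>V a\<close> with
    \<open>a\<close> in \<open>J\<close> must stay away from at least one of them, uniformly in the
    point.\<close>
  have *: "\<forall>\<^sub>F \<delta> in at_right (0::real).
      \<forall>x\<in>K. (\<forall>a\<in>J. f a x \<notin> V a) \<longrightarrow> (\<exists>a\<in>J. \<delta> \<le> infdist (f a x) (V a))"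
    if J: "J \<subseteq> I" "m < card J" for J
  proof -
    have finJ: "finite J" using J fin finite_subset by blast
    have contJ: "continuous_on K (f a)" if "a \<in> J" for a using cont J that by blast
    define KJ where "KJ = {x\<in>K. \<forall>a\<in>J. f a x \<notin> V a}"
    define s where "s x = (\<Sum>a\<in>J. infdist (f a x) (V a))" for x
    have s_pos: "0 < s x" if x: "x \<in> KJ" for x
    proof (rule ccontr)
      assume "\<not> 0 < s x"
      moreover have "0 \<le> s x" unfolding s_def by (intro sum_nonneg infdist_nonneg)
      ultimately have "s x = 0" by simp
      then have z: "infdist (f a x) (V a) = 0" if "a \<in> J" for a
        using that finJ unfolding s_def by (simp add: sum_nonneg_eq_0_iff infdist_nonneg)
      \<comment> \<open>Distance zero to a nonempty set means membership in its closure, and an open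
        set without \<open>f a x\<close> keeps that point out of its interior.\<close>
      have "f a x \<in> frontier (V a)" if "a \<in> J" for a
        using z[OF that] V[of a] J that x
        by (auto simp: KJ_def frontier_def interior_open in_closure_iff_infdist_zero)
      then have "card J \<le> card {a\<in>I. f a x \<in> frontier (V a)}"
        using J fin by (intro card_mono) auto
      then show False using m[of x] J x by (simp add: KJ_def)
    qed
    have "compact KJ"
    proof -
      \<comment> \<open>\<open>J\<close> is nonempty because it has more than \<open>m\<close>
        elements; an empty intersection would not be contained in \<open>K\<close>.\<close>
      have "KJ = (\<Inter>a\<in>J. K \<inter> f a -` (- V a))" "J \<noteq> {}" unfolding KJ_def using J by auto
      moreover have "closedin (top_of_set K) (K \<inter> f a -` (- V a))" if "a \<in> J" for a
        using that contJ V J by (intro continuous_closedin_preimage) auto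
      ultimately have "closedin (top_of_set K) KJ" by (simp only: closedin_INT not_False_eq_True)
      then show ?thesis using K closedin_compact by blast
    qed
    have "continuous_on KJ s"
      unfolding s_def using contJ
      by (intro continuous_intros) (auto simp: KJ_def intro: continuous_on_subset)
    obtain d where d: "0 < d" "\<And>x. x \<in> KJ \<Longrightarrow> d \<le> s x"
    proof (cases "KJ = {}")
      case False
      then obtain y where "y \<in> KJ" "\<forall>x\<in>KJ. s y \<le> s x"
        using continuous_attains_inf[OF \<open>compact KJ\<close> _ \<open>continuous_on KJ s\<close>] by blast
      then show ?thesis using that[of "s y"] s_pos by blast
    qed (auto intro: that[of 1])
    \<comment> \<open>If every distance is below \<open>e\<close>, then \<open>s x\<close> is at
      most \<open>card J * e\<close>; the \<open>+ 1\<close> makes this strictly less than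
      \<open>d\<close>.\<close>
    define e where "e = d / (real (card J) + 1)"
    have "0 < e" unfolding e_def using d by simp
    have "\<exists>a\<in>J. \<delta> \<le> infdist (f a x) (V a)" if "x \<in> KJ" "\<delta> < e" for x \<delta>
    proof (rule ccontr)
      assume "\<not> ?thesis"
      then have "s x \<le> real (card J) * \<delta>"
        unfolding s_def by (intro sum_bounded_above) auto
      also have "\<dots> \<le> real (card J) * e" using that by (intro mult_left_mono) auto
      also have "\<dots> < d" unfolding e_def using d by (simp add: field_simps)
      finally show False using d(2)[OF that(1)] by simp
    qed
    then show ?thesis
      using \<open>0 < e\<close> unfolding eventually_at_right_field KJ_def by blast
  qed
  \<comment> \<open>Only finitely many \<open>J\<close> occur, so one small \<delta> serves them
    all.\<close>
  have "\<forall>\<^sub>F \<delta> in at_right (0::real). \<forall>J\<in>{J\<in>Pow I. m < card J}.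
      \<forall>x\<in>K. (\<forall>a\<in>J. f a x \<notin> V a) \<longrightarrow> (\<exists>a\<in>J. \<delta> \<le> infdist (f a x) (V a))"
    using fin * by (intro eventually_ball_finite) auto
  then show ?thesis
  proof eventually_elim
    case (elim \<delta>)
    show ?case
    proof (intro ballI leI notI)
      fix x
      let ?J = "{a\<in>I. 0 < infdist (f a x) (V a) \<and> infdist (f a x) (V a) < \<delta>}"
      assume x: "x \<in> K" and "m < card ?J"
      then have "?J \<in> {J\<in>Pow I. m < card J}" by blast
      moreover have "\<forall>a\<in>?J. f a x \<notin> V a" by auto
      ultimately have "\<exists>a\<in>?J. \<delta> \<le> infdist (f a x) (V a)" using elim x by blast
      then show False by auto
    qed
  qed
qed

section \<open>Orbits of the base, the cocycle and visit frequencies\<close>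

context continuous_bundle_rds
begin

lemma base_iterate_measurable: "\<theta> ^^ n \<in> measurable M M"
  by (induction n) (auto intro: measurable_compose[OF _ base_measurable])

lemma distr_base_iterate: "distr M M (\<theta> ^^ n) = M"
proof (induction n)
  case 0
  show ?case using distr_id[of M] by (simp add: id_def)
next
  case (Suc n)
  have "distr M M (\<theta> ^^ Suc n) = distr (distr M M (\<theta> ^^ n)) M \<theta>"
    by (simp add: distr_distr[OF base_measurable base_iterate_measurable])
  then show ?case by (simp only: Suc base_preserving)
qed

lemma base_iterate_space: "\<omega> \<in> space M \<Longrightarrow> (\<theta> ^^ n) \<omega> \<in> space M"
  using base_iterate_measurable measurable_space by metis

text \<open>Every iterate of \<theta> preserves \<open>M\<close>, so the exceptional null set pulls
  back to null sets, and there are countably many iterates.\<close>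

lemma AE_orbit_continuous:
  "AE \<omega> in M. \<forall>i. continuous_on (fiber E ((\<theta> ^^ i) \<omega>)) (T ((\<theta> ^^ i) \<omega>))"
proof -
  have "AE \<omega> in distr M M (\<theta> ^^ i). continuous_on (fiber E \<omega>) (T \<omega>)" for i
    unfolding distr_base_iterate by (rule map_continuous)
  from AE_distrD[OF base_iterate_measurable this]
  show ?thesis by (simp add: AE_all_countable)
qed

lemma cocycle_in_fiber:
  "\<omega> \<in> space M \<Longrightarrow> x \<in> fiber E \<omega> \<Longrightarrow> cocycle \<theta> T i \<omega> x \<in> fiber E ((\<theta> ^^ i) \<omega>)"
proof (induction i)
  case (Suc i)
  then show ?case using fiber_map[OF base_iterate_space[OF Suc.prems(1), of i]] by auto
qed simp

lemma cocycle_continuous: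
  assumes "\<omega> \<in> space M" and "\<forall>i. continuous_on (fiber E ((\<theta> ^^ i) \<omega>)) (T ((\<theta> ^^ i) \<omega>))"
  shows "continuous_on (fiber E \<omega>) (cocycle \<theta> T i \<omega>)"
proof (induction i)
  case (Suc i)
  have "cocycle \<theta> T i \<omega> ` fiber E \<omega> \<subseteq> fiber E ((\<theta> ^^ i) \<omega>)"
    using cocycle_in_fiber assms(1) by blast
  then have "continuous_on (cocycle \<theta> T i \<omega> ` fiber E \<omega>) (T ((\<theta> ^^ i) \<omega>))"
    using assms(2) continuous_on_subset by blast
  then show ?case unfolding cocycle.simps by (rule continuous_on_compose[OF Suc])
qed (simp add: continuous_on_id')

lemma visit_count_le:
  assumes "x \<in> fiber E \<omega>"
  shows "(\<Sum>i<n. indicator A (cocycle \<theta> T i \<omega> x)) \<le> real n * max_visit_freq \<theta> E T \<omega> A n"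
proof (cases "n = 0")
  case False
  have "(\<Sum>i<n. indicator A (cocycle \<theta> T i \<omega> y)) \<le> real n" for y
    by (rule order_trans[OF sum_indicator_le_card]) simp
  then have "(\<Sum>i<n. indicator A (cocycle \<theta> T i \<omega> x) :: real)
      \<le> (SUP x\<in>fiber E \<omega>. \<Sum>i<n. indicator A (cocycle \<theta> T i \<omega> x))"
    using assms by (intro cSUP_upper) (auto intro!: bdd_aboveI)
  then show ?thesis using False by (simp add: max_visit_freq_def)
qed simp

lemma max_visit_freq_bounds:
  assumes "\<omega> \<in> space M"
  shows "0 \<le> max_visit_freq \<theta> E T \<omega> A n" "max_visit_freq \<theta> E T \<omega> A n \<le> 1"
proof -
  obtain x where x: "x \<in> fiber E \<omega>" using fiber_nonempty[OF assms] by blast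
  have "0 \<le> (\<Sum>i<n. indicator A (cocycle \<theta> T i \<omega> x) :: real)" by (intro sum_nonneg) auto
  also note visit_count_le[OF x]
  finally show "0 \<le> max_visit_freq \<theta> E T \<omega> A n"
    by (cases "n = 0") (auto simp: max_visit_freq_def zero_le_mult_iff)
  have "(\<Sum>i<n. indicator A (cocycle \<theta> T i \<omega> y)) \<le> real n" for y
    by (rule order_trans[OF sum_indicator_le_card]) simp
  then have "(SUP x\<in>fiber E \<omega>. \<Sum>i<n. indicator A (cocycle \<theta> T i \<omega> x)) \<le> real n"
    using x by (intro cSUP_least) auto
  then show "max_visit_freq \<theta> E T \<omega> A n \<le> 1"
    by (cases "n = 0") (auto simp: max_visit_freq_def field_simps)
qed

section \<open>From the dimension estimate on one fiber to mean dimension zero\<close>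

text \<open>The cube has one coordinate for each pair of a time \<open>i < n\<close> and a center in
  \<open>J\<close>. The number of fractional coordinates is controlled by the total number of
  frontier visits, and the Kuhn stars refine the iterated cover.\<close>

lemma cover_dim_iterated_cover_bounds:
  assumes \<omega>: "\<omega> \<in> space M"
    and cont: "\<forall>i. continuous_on (fiber E ((\<theta> ^^ i) \<omega>)) (T ((\<theta> ^^ i) \<omega>))"
    and finJ: "finite J" and e: "0 < e"
    and A: "\<And>c. c \<in> J \<Longrightarrow> A c \<in> \<alpha> \<and> ball c e \<subseteq> A c"
    and V: "\<And>c. c \<in> J \<Longrightarrow> c \<in> interior (V c) \<and> V c \<subseteq> ball c (e / 2)"
    and cover: "(\<Union>c\<in>J. interior (V c)) = UNIV"
  shows "0 \<le> cover_dim (fiber E \<omega>) (iterated_cover \<theta> E T \<alpha> n \<omega>)"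
    and "cover_dim (fiber E \<omega>) (iterated_cover \<theta> E T \<alpha> n \<omega>)
      \<le> real n * (\<Sum>c\<in>J. max_visit_freq \<theta> E T \<omega> (frontier (V c)) n)"
proof -
  let ?K = "fiber E \<omega>"
  define I where "I = {..<n} \<times> J"
  define f where "f a = cocycle \<theta> T (fst a) \<omega>" for a :: "nat \<times> 'x"
  \<comment> \<open>The collar estimate requires open sets; passing to the interior can only shrink
    the frontier.\<close>
  define W where "W a = interior (V (snd a))" for a :: "nat \<times> 'x"
  define r where "r = real n * (\<Sum>c\<in>J. max_visit_freq \<theta> E T \<omega> (frontier (V c)) n)"
  have finI: "finite I" unfolding I_def using finJ by simp
  have contf: "continuous_on ?K (f a)" for a
    unfolding f_def by (rule cocycle_continuous[OF \<omega> cont])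
  have r_nonneg: "0 \<le> r"
    unfolding r_def by (intro mult_nonneg_nonneg sum_nonneg max_visit_freq_bounds \<omega>) auto
  have card_le: "card {a\<in>I. f a x \<in> frontier (W a)} \<le> nat \<lfloor>r\<rfloor>" if x: "x \<in> ?K" for x
  proof -
    have "real (card {a\<in>I. f a x \<in> frontier (W a)}) = (\<Sum>a\<in>I. indicator (frontier (W a)) (f a x))"
      using finI by (simp add: indicator_def sum.If_cases Int_def conj_commute)
    also have "\<dots> \<le> (\<Sum>a\<in>I. indicator (frontier (V (snd a))) (f a x))"
      unfolding W_def using frontier_interior_subset
      by (intro sum_mono) (auto simp: indicator_def)
    also have "\<dots> = (\<Sum>c\<in>J. \<Sum>i<n. indicator (frontier (V c)) (cocycle \<theta> T i \<omega> x))"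
      unfolding I_def f_def by (subst sum.swap) (simp add: sum.cartesian_product case_prod_beta)
    also have "\<dots> \<le> r"
      unfolding r_def sum_distrib_left by (intro sum_mono visit_count_le x)
    finally show ?thesis by linarith
  qed
  have "\<forall>\<^sub>F \<delta> in at_right (0::real).
      \<forall>x\<in>?K. card {a\<in>I. 0 < infdist (f a x) (W a) \<and> infdist (f a x) (W a) < \<delta>} \<le> nat \<lfloor>r\<rfloor>"
    using V by (intro eventually_card_collar_le fiber_compact \<omega> finI contf card_le)
      (fastforce simp: W_def I_def)+
  moreover have "\<forall>\<^sub>F \<delta> in at_right (0::real). \<delta> \<in> {0<..<e / 2}"
    using e by (intro eventually_at_right_real) simp
  ultimately have "\<forall>\<^sub>F \<delta> in at_right (0::real). \<delta> \<in> {0<..<e / 2} \<and>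
      (\<forall>x\<in>?K. card {a\<in>I. 0 < infdist (f a x) (W a) \<and> infdist (f a x) (W a) < \<delta>} \<le> nat \<lfloor>r\<rfloor>)"
    by (rule eventually_conj[rotated])
  from eventually_happens[OF this]
  obtain \<delta> where \<delta>: "0 < \<delta>" "\<delta> < e / 2"
    and collar: "\<And>x. x \<in> ?K \<Longrightarrow>
      card {a\<in>I. 0 < infdist (f a x) (W a) \<and> infdist (f a x) (W a) < \<delta>} \<le> nat \<lfloor>r\<rfloor>"
    by (simp only: trivial_limit_at_right_real simp_thms greaterThanLessThan_iff) blast
  \<comment> \<open>The tent equals 1 where the distance to \<open>W a\<close> is zero and vanishes
    from distance \<delta> on, so it is fractional exactly on the open collar counted in
    \<open>collar\<close>.\<close>
  define t where "t a x = max 0 (1 - infdist (f a x) (W a) / \<delta>)" for a x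
  have t_pos: "0 < t a x \<longleftrightarrow> infdist (f a x) (W a) < \<delta>"
    and t_less: "t a x < 1 \<longleftrightarrow> 0 < infdist (f a x) (W a)"
    and t_bounds: "0 \<le> t a x" "t a x \<le> 1" for a x
    unfolding t_def using \<delta>(1) infdist_nonneg[of "f a x" "W a"]
    by (auto simp: less_max_iff_disj zero_less_divide_iff divide_less_eq)
  define \<beta> where "\<beta> = kuhn_star ?K I t ` Pow I"
  have t_cont: "continuous_on ?K (t a)" for a
    unfolding t_def using \<delta>(1) by (intro continuous_intros contf) auto
  have fractional: "card {a\<in>I. 0 < t a x \<and> t a x < 1} \<le> nat \<lfloor>r\<rfloor>" if "x \<in> ?K" for x
    using collar[OF that] by (simp add: t_pos t_less conj_commute)
  have \<beta>: "finite_open_cover ?K \<beta>" "cover_ord ?K \<beta> \<le> int (nat \<lfloor>r\<rfloor>)"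
    unfolding \<beta>_def using kuhn_cover[OF finI t_cont fiber_nonempty[OF \<omega>] _ fractional] t_bounds by blast+
  have "refines \<beta> (iterated_cover \<theta> E T \<alpha> n \<omega>)"
    unfolding refines_def
  proof
    fix U assume "U \<in> \<beta>"
    then obtain S where S: "S \<subseteq> I" "U = kuhn_star ?K I t S" unfolding \<beta>_def by blast
    \<comment> \<open>\<open>c0\<close> is a dummy center for times without a pair in
      \<open>S\<close>. Such a time is either at least \<open>n\<close>, or forces the star to be
      empty.\<close>
    obtain c0 where c0: "c0 \<in> J" using cover by blast
    have "\<forall>i. \<exists>c\<in>J. (\<exists>c'. (i, c') \<in> S) \<longrightarrow> (i, c) \<in> S"
      using S(1) c0 unfolding I_def by blast
    then obtain c where c: "\<And>i. c i \<in> J" "\<And>i c'. (i, c') \<in> S \<Longrightarrow> (i, c i) \<in> S" by metis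
    define B where "B i = A (c i) \<inter> fiber E ((\<theta> ^^ i) \<omega>)" for i
    have "cocycle \<theta> T i \<omega> x \<in> B i" if x: "x \<in> U" and i: "i < n" for x i
    proof -
      have xK: "x \<in> ?K" using x S unfolding kuhn_star_def by blast
      \<comment> \<open>The orbit point lies in some \<open>W (i, c')\<close>, where the tent has
        value 1; such a coordinate belongs to every vertex whose star contains \<open>x\<close>.
        This ensures that \<open>S\<close> has a pair at time \<open>i\<close>.\<close>
      obtain c' where c': "c' \<in> J" "f (i, c') x \<in> W (i, c')"
        using cover unfolding W_def f_def fst_conv snd_conv by blast
      then have "\<not> t (i, c') x < 1" by (simp add: t_less)
      then have "(i, c') \<in> S"
        using x S c' i unfolding kuhn_star_def I_def by auto
      then have "(i, c i) \<in> S" by (rule c(2))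
      \<comment> \<open>Positivity puts the orbit point within \<delta> of
        \<open>W (i, c i)\<close>, which lies in the ball of radius \<open>e / 2\<close>; since
        \<delta> is below \<open>e / 2\<close>, the point lies in the ball of radius
        \<open>e\<close> and thus in \<open>A (c i)\<close>.\<close>
      then have "0 < t (i, c i) x" using x S unfolding kuhn_star_def by auto
      then have less: "infdist (f (i, c i) x) (W (i, c i)) < \<delta>" by (simp add: t_pos)
      have "W (i, c i) \<noteq> {}" using V[OF c(1)] unfolding W_def by auto
      then obtain y where y: "y \<in> W (i, c i)" "dist (f (i, c i) x) y < \<delta>"
        using less by (auto simp: infdist_def cINF_less_iff)
      have "y \<in> ball (c i) (e / 2)"
        using y V[OF c(1)] interior_subset unfolding W_def by fastforce
      then have "f (i, c i) x \<in> ball (c i) e"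
        using y(2) \<delta>(2) dist_triangle[of "c i" "f (i, c i) x" y]
        by (simp add: dist_commute)
      then have "cocycle \<theta> T i \<omega> x \<in> A (c i)"
        using A[OF c(1)] unfolding f_def fst_conv by blast
      then show ?thesis
        unfolding B_def using cocycle_in_fiber[OF \<omega> xK] by simp
    qed
    then have "U \<subseteq> {x\<in>?K. \<forall>i<n. cocycle \<theta> T i \<omega> x \<in> B i}"
      using S unfolding kuhn_star_def by auto
    moreover have "\<forall>i<n. B i \<in> trace_cover E \<alpha> ((\<theta> ^^ i) \<omega>)"
      unfolding B_def trace_cover_def using A c(1) by blast
    ultimately show "\<exists>U'\<in>iterated_cover \<theta> E T \<alpha> n \<omega>. U \<subseteq> U'"
      unfolding iterated_cover_def by blast
  qed
  note dim = cover_dim_bounds[OF \<beta>(1) this fiber_nonempty[OF \<omega>]]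
  show "0 \<le> cover_dim ?K (iterated_cover \<theta> E T \<alpha> n \<omega>)" by (rule dim(1))
  have "cover_dim ?K (iterated_cover \<theta> E T \<alpha> n \<omega>) \<le> int (nat \<lfloor>r\<rfloor>)" using dim(2) \<beta>(2) by simp
  then show "cover_dim ?K (iterated_cover \<theta> E T \<alpha> n \<omega>)
      \<le> real n * (\<Sum>c\<in>J. max_visit_freq \<theta> E T \<omega> (frontier (V c)) n)"
    using r_nonneg unfolding r_def[symmetric] by linarith
qed

text \<open>Measurability of \<open>f n\<close> is not assumed: a nonmeasurable function has Bochner integral \<open>0\<close>.\<close>

lemma tendsto_integral_bounded:
  fixes f :: "nat \<Rightarrow> 'w \<Rightarrow> real"
  assumes "AE \<omega> in M. (\<lambda>n. f n \<omega>) \<longlonglongrightarrow> 0" and "\<And>n. AE \<omega> in M. \<bar>f n \<omega>\<bar> \<le> C"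
  shows "(\<lambda>n. \<integral>\<omega>. f n \<omega> \<partial>M) \<longlonglongrightarrow> 0"
proof -
  \<comment> \<open>\<open>g n\<close> is measurable, has the same integral as \<open>f n\<close>
    and is pointwise no larger in norm, so dominated convergence applies to it.\<close>
  define g where "g n = (if f n \<in> borel_measurable M then f n else (\<lambda>_. 0))" for n
  have "(\<integral>\<omega>. f n \<omega> \<partial>M) = (\<integral>\<omega>. g n \<omega> \<partial>M)" for n
    using not_integrable_integral_eq[of M "f n"] unfolding g_def
    by (auto dest: borel_measurable_integrable)
  moreover have "(\<lambda>n. \<integral>\<omega>. g n \<omega> \<partial>M) \<longlonglongrightarrow> (\<integral>\<omega>. 0 \<partial>M)"
  proof (rule integral_dominated_convergence[where w = "\<lambda>_. \<bar>C\<bar>"])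
    show "AE \<omega> in M. (\<lambda>n. g n \<omega>) \<longlonglongrightarrow> 0"
      using assms(1)
    proof eventually_elim
      case (elim \<omega>)
      have "norm (g n \<omega>) \<le> norm (f n \<omega>)" for n by (simp add: g_def)
      then show ?case by (intro Lim_null_comparison[OF _ tendsto_norm_zero[OF elim]] always_eventually) simp
    qed
    show "AE \<omega> in M. norm (g n \<omega>) \<le> \<bar>C\<bar>" for n
      using assms(2)[of n] by eventually_elim (auto simp: g_def)
  qed (auto simp: g_def)
  ultimately show ?thesis by simp
qed

text \<open>Almost surely, the dimension per step lies between 0 and a finite sum of visit
  frequencies of small frontiers. That sum tends to 0 and is bounded by \<open>card J\<close>, so
  the integrals tend to 0.\<close>

lemma mdim_cover_eq_0:
  assumes sbp: "small_boundary_property M \<theta> E T" and \<alpha>: "finite_open_cover UNIV \<alpha>"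
  shows "mdim_cover M \<theta> E T \<alpha> = 0"
proof -
  have "UNIV \<subseteq> \<Union>\<alpha>" "\<And>U. U \<in> \<alpha> \<Longrightarrow> open U"
    using \<alpha> unfolding finite_open_cover_def by auto
  \<comment> \<open>\<open>e\<close> is a Lebesgue number of \<alpha>. Half of it bounds the
    neighborhoods \<open>V\<close>, the other half leaves room for the tents.\<close>
  then obtain e where e: "0 < e" "\<And>x. \<exists>U\<in>\<alpha>. ball x e \<subseteq> U"
    using Heine_Borel_lemma[OF compact_UNIV, of \<alpha>] by (metis UNIV_I)
  then obtain A where A: "\<And>x. A x \<in> \<alpha> \<and> ball x e \<subseteq> A x" by metis
  have "\<forall>x. \<exists>V. V \<subseteq> ball x (e / 2) \<and> x \<in> interior V \<and> small_set M \<theta> E T (frontier V)"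
    using sbp e(1) unfolding small_boundary_property_def by simp
  then obtain V where V: "\<And>x. V x \<subseteq> ball x (e / 2)" "\<And>x. x \<in> interior (V x)"
    "\<And>x. small_set M \<theta> E T (frontier (V x))" by metis
  obtain J where J: "finite J" "UNIV \<subseteq> (\<Union>c\<in>J. interior (V c))"
    using compactE_image[OF compact_UNIV, of UNIV "\<lambda>x. interior (V x)"] V(2) by auto blast
  define freq where "freq n \<omega> = (\<Sum>c\<in>J. max_visit_freq \<theta> E T \<omega> (frontier (V c)) n)" for n \<omega>
  define D where
    "D n \<omega> = (1 / real n) * real_of_int (cover_dim (fiber E \<omega>) (iterated_cover \<theta> E T \<alpha> n \<omega>))"
    for n \<omega>
  have D: "AE \<omega> in M. \<forall>n. 0 \<le> D n \<omega> \<and> D n \<omega> \<le> freq n \<omega>"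
    using AE_orbit_continuous AE_space
  proof eventually_elim
    case (elim \<omega>)
    have "0 \<le> D n \<omega> \<and> D n \<omega> \<le> freq n \<omega>" for n
    proof (cases "n = 0")
      \<comment> \<open>Here \<open>1 / real 0 = 0\<close>, so \<open>D n \<omega>\<close> is
        0.\<close>
      case True
      then show ?thesis
        by (simp add: D_def freq_def sum_nonneg max_visit_freq_bounds(1)[OF elim(2)])
    next
      case False
      have "0 \<le> cover_dim (fiber E \<omega>) (iterated_cover \<theta> E T \<alpha> n \<omega>)"
        "cover_dim (fiber E \<omega>) (iterated_cover \<theta> E T \<alpha> n \<omega>) \<le> real n * freq n \<omega>"
        unfolding freq_def
        by (rule cover_dim_iterated_cover_bounds[OF elim(2,1) J(1) e(1), where A = A]; use A V J in auto)+
      then show ?thesis using False by (simp add: D_def field_simps)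
    qed
    then show ?case by blast
  qed
  have freq: "freq n \<omega> \<le> card J" if "\<omega> \<in> space M" for n \<omega>
    using sum_bounded_above[of J "\<lambda>c. max_visit_freq \<theta> E T \<omega> (frontier (V c)) n" 1]
      max_visit_freq_bounds[OF that] by (simp add: freq_def)
  have bound: "AE \<omega> in M. \<bar>D n \<omega>\<bar> \<le> card J" for n
    using D AE_space by eventually_elim (auto intro: order_trans freq)
  have "AE \<omega> in M. \<forall>c\<in>J. max_visit_freq \<theta> E T \<omega> (frontier (V c)) \<longlonglongrightarrow> 0"
  proof (subst AE_finite_all[OF J(1)], intro ballI)
    fix c
    have "AE \<omega> in M. convergent (max_visit_freq \<theta> E T \<omega> (frontier (V c)))
        \<and> ocap \<theta> E T \<omega> (frontier (V c)) = 0"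
      using V(3) unfolding small_set_def by blast
    then show "AE \<omega> in M. max_visit_freq \<theta> E T \<omega> (frontier (V c)) \<longlonglongrightarrow> 0"
      unfolding ocap_def by eventually_elim (metis convergent_LIMSEQ_iff)
  qed
  then have "AE \<omega> in M. (\<lambda>n. freq n \<omega>) \<longlonglongrightarrow> 0"
    unfolding freq_def by eventually_elim (auto intro: tendsto_null_sum)
  with D have "AE \<omega> in M. (\<lambda>n. D n \<omega>) \<longlonglongrightarrow> 0"
  proof eventually_elim
    case (elim \<omega>)
    then show ?case
      by (intro tendsto_sandwich[OF _ _ tendsto_const elim(2)]) auto
  qed
  then have "(\<lambda>n. \<integral>\<omega>. D n \<omega> \<partial>M) \<longlonglongrightarrow> 0" using bound by (rule tendsto_integral_bounded)
  then show ?thesis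
    unfolding mdim_cover_def D_def by (simp add: limI)
qed

end

theorem theorem4p1:
  fixes M :: "'w measure"
    and \<theta> :: "'w \<Rightarrow> 'w"
    and E :: "('w \<times> 'x::metric_space) set"
    and T :: "'w \<Rightarrow> 'x \<Rightarrow> 'x"
  assumes "continuous_bundle_rds M \<theta> E T"
    and "small_boundary_property M \<theta> E T"
  shows "mdim M \<theta> E T = 0"
proof -
  interpret continuous_bundle_rds M \<theta> E T by fact
  \<comment> \<open>Some cover must exist: the supremum of the empty set in \<open>ereal\<close> is
    minus infinity, not 0.\<close>
  have "finite_open_cover UNIV {UNIV :: 'x set}" unfolding finite_open_cover_def by simp
  then have "{\<alpha> :: 'x set set. finite_open_cover UNIV \<alpha>} \<noteq> {}" by blast
  then show ?thesis
    unfolding mdim_def using mdim_cover_eq_0[OF assms(2)] by (simp add: zero_ereal_def)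
qed

end
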